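(* Let $G = N \rtimes H$ be an isometry group constructed as an outer semidirect product of a normal subgroup $N$ and a subgroup $H$. Identify $h \in H$ with $(e_N,h) \in G$. Then any indirect isometry of $H$ is an indirect isometry of $G$.
   Context: An isometry group is a group of isometries of some space; no assumption is made on the space, and the invariance defining its isometries need not come from a true metric, so only the group structure matters. An element of an isometry group $\Gamma$ is called a direct isometry of $\Gamma$ when it can be expressed as a (finite) product of squares of elements of $\Gamma$; otherwise it is called an indirect isometry of $\Gamma$. Thus directness is always relative to a specified group. The outer semidirect product $N \rtimes H$ is taken with respect to a homomorphism $\phi: H \to \mathrm{Aut}(N)$, $h \mapsto \phi_h$; its elements are pairs $(n,h)$ with $n\in N$, $h\in H$ and its operation is $(n_1,h_1)(n_2,h_2) = (n_1\,\phi_{h_1}(n_2),\, h_1h_2)$. The neutral elements of $N$ and $H$ are $e_N$ and $e_H$. *)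

theory Defs
  imports "HOL-Algebra.Bij"
begin

text \<open>An isometry group enters only through its group structure, so it is rendered as a group.
  The empty list in the following definition contributes nothing new: the
  neutral element is its own square.\<close>

definition direct_isometry :: "('a, 'm) monoid_scheme \<Rightarrow> 'a \<Rightarrow> bool" where
  "direct_isometry G x \<longleftrightarrow>
     (\<exists>gs. set gs \<subseteq> carrier G \<and>
           x = foldr (\<otimes>\<^bsub>G\<^esub>) (map (\<lambda>g. g \<otimes>\<^bsub>G\<^esub> g) gs) \<one>\<^bsub>G\<^esub>)"

definition indirect_isometry :: "('a, 'm) monoid_scheme \<Rightarrow> 'a \<Rightarrow> bool" where
  "indirect_isometry G x \<longleftrightarrow> x \<in> carrier G \<and> \<not> direct_isometry G x"

definition semidirect_product ::
  "('a, 'm) monoid_scheme \<Rightarrow> ('b, 'n) monoid_scheme \<Rightarrow> ('b \<Rightarrow> 'a \<Rightarrow> 'a) \<Rightarrow> ('a \<times> 'b) monoid" where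
  "semidirect_product N H \<phi> =
     \<lparr>carrier = carrier N \<times> carrier H,
      mult = (\<lambda>(n\<^sub>1, h\<^sub>1) (n\<^sub>2, h\<^sub>2). (n\<^sub>1 \<otimes>\<^bsub>N\<^esub> \<phi> h\<^sub>1 n\<^sub>2, h\<^sub>1 \<otimes>\<^bsub>H\<^esub> h\<^sub>2)),
      one = (\<one>\<^bsub>N\<^esub>, \<one>\<^bsub>H\<^esub>)\<rparr>"

lemma semidirect_action:
  assumes "group N" "group H" "\<phi> \<in> hom H (AutoGroup N)"
  shows "\<And>h. h \<in> carrier H \<Longrightarrow> \<phi> h \<in> hom N N"
    and "\<And>h n. h \<in> carrier H \<Longrightarrow> n \<in> carrier N \<Longrightarrow> \<phi> h n \<in> carrier N"
    and "\<And>h k n. h \<in> carrier H \<Longrightarrow> k \<in> carrier H \<Longrightarrow> n \<in> carrier N \<Longrightarrow>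
          \<phi> (h \<otimes>\<^bsub>H\<^esub> k) n = \<phi> h (\<phi> k n)"
    and "\<And>n. n \<in> carrier N \<Longrightarrow> \<phi> \<one>\<^bsub>H\<^esub> n = n"
    and "\<And>h. h \<in> carrier H \<Longrightarrow> \<phi> h \<one>\<^bsub>N\<^esub> = \<one>\<^bsub>N\<^esub>"
proof -
  have aut: "\<phi> h \<in> auto N" if "h \<in> carrier H" for h
    using hom_in_carrier[OF assms(3) that] by (simp add: AutoGroup_def)
  then show hom: "\<phi> h \<in> hom N N" if "h \<in> carrier H" for h
    using that by (simp add: auto_def)
  then show "\<phi> h n \<in> carrier N" if "h \<in> carrier H" "n \<in> carrier N" for h n
    using that hom_in_carrier by metis
  show "\<phi> (h \<otimes>\<^bsub>H\<^esub> k) n = \<phi> h (\<phi> k n)"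
    if "h \<in> carrier H" "k \<in> carrier H" "n \<in> carrier N" for h k n
    using hom_mult[OF assms(3) that(1,2)] aut[OF that(1)] aut[OF that(2)] that(3)
    by (simp add: AutoGroup_def BijGroup_def auto_def compose_def)
  have "\<phi> \<one>\<^bsub>H\<^esub> = \<one>\<^bsub>AutoGroup N\<^esub>"
    by (rule hom_one[OF assms(3,2) group.AutoGroup[OF assms(1)]])
  then show "\<phi> \<one>\<^bsub>H\<^esub> n = n" if "n \<in> carrier N" for n
    using that by (simp add: AutoGroup_def BijGroup_def)
  show "\<phi> h \<one>\<^bsub>N\<^esub> = \<one>\<^bsub>N\<^esub>" if "h \<in> carrier H" for h
    by (rule hom_one[OF hom[OF that] assms(1,1)])
qed

lemma group_semidirect_product:
  assumes N: "group N" and H: "group H" and \<phi>: "\<phi> \<in> hom H (AutoGroup N)"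
  shows "group (semidirect_product N H \<phi>)"
proof -
  interpret N: group N by fact
  interpret H: group H by fact
  note act = semidirect_action[OF N H \<phi>]
  have inv: "\<exists>y\<in>carrier N \<times> carrier H.
      (case y of (n', h') \<Rightarrow> (n' \<otimes>\<^bsub>N\<^esub> \<phi> h' n, h' \<otimes>\<^bsub>H\<^esub> h)) = (\<one>\<^bsub>N\<^esub>, \<one>\<^bsub>H\<^esub>)"
    if "n \<in> carrier N" "h \<in> carrier H" for n h
    using that
    by (intro bexI[of _ "(inv\<^bsub>N\<^esub> (\<phi> (inv\<^bsub>H\<^esub> h) n), inv\<^bsub>H\<^esub> h)"]) (auto simp: act)
  show ?thesis
    by (rule groupI)
       (use inv in \<open>auto simp: semidirect_product_def act hom_mult[OF act(1)] N.m_assoc H.m_assoc\<close>)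
qed

lemma semidirect_product_embedding:
  assumes "group N" "group H" "\<phi> \<in> hom H (AutoGroup N)"
  shows "(\<lambda>h. (\<one>\<^bsub>N\<^esub>, h)) \<in> hom H (semidirect_product N H \<phi>)"
    and "inj_on (\<lambda>h. (\<one>\<^bsub>N\<^esub>, h)) (carrier H)"
proof -
  interpret N: group N by fact
  show "(\<lambda>h. (\<one>\<^bsub>N\<^esub>, h)) \<in> hom H (semidirect_product N H \<phi>)"
    by (auto simp: hom_def semidirect_product_def semidirect_action[OF assms])
qed (simp add: inj_on_def)

end

theory Submission
  imports Defs
begin

text \<open>Homomorphisms send products of squares to products of squares. Applied to the projection
  of the semidirect product onto \<open>H\<close>, which is a left inverse of the embedding of \<open>H\<close>, this shows
  that \<open>h\<close> is direct in \<open>H\<close> whenever \<open>(\<one>, h)\<close> is direct in the product.\<close>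

lemma direct_isometry_hom:
  assumes "group G" "group K" "f \<in> hom G K" "direct_isometry G x"
  shows "direct_isometry K (f x)"
proof -
  interpret G: group G by fact
  obtain gs where gs: "set gs \<subseteq> carrier G"
    and x: "x = foldr (\<otimes>\<^bsub>G\<^esub>) (map (\<lambda>g. g \<otimes>\<^bsub>G\<^esub> g) gs) \<one>\<^bsub>G\<^esub>"
    using assms(4) by (auto simp: direct_isometry_def)
  \<comment> \<open>Carrier membership is part of the induction because \<open>hom_mult\<close>
    applies only to elements of the carrier; the empty product is handled by
    \<open>hom_one\<close>.\<close>
  have "foldr (\<otimes>\<^bsub>G\<^esub>) (map (\<lambda>g. g \<otimes>\<^bsub>G\<^esub> g) gs) \<one>\<^bsub>G\<^esub> \<in> carrier G \<and>
    f (foldr (\<otimes>\<^bsub>G\<^esub>) (map (\<lambda>g. g \<otimes>\<^bsub>G\<^esub> g) gs) \<one>\<^bsub>G\<^esub>) =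
      foldr (\<otimes>\<^bsub>K\<^esub>) (map (\<lambda>g. g \<otimes>\<^bsub>K\<^esub> g) (map f gs)) \<one>\<^bsub>K\<^esub>"
    using gs by (induction gs) (auto simp: hom_one[OF assms(3,1,2)] hom_mult[OF assms(3)])
  moreover have "set (map f gs) \<subseteq> carrier K"
    using gs hom_in_carrier[OF assms(3)] by auto
  ultimately show ?thesis
    unfolding direct_isometry_def x by blast
qed

text \<open>The twist by \<open>\<phi>\<close> affects only first coordinates; second coordinates
  multiply exactly as in \<open>H\<close>.\<close>

lemma semidirect_product_projection: "snd \<in> hom (semidirect_product N H \<phi>) H"
  by (auto simp: hom_def semidirect_product_def)

theorem theorem3:
  fixes N :: "('a, 'm) monoid_scheme" and H :: "('b, 'n) monoid_scheme"
    and \<phi> :: "'b \<Rightarrow> 'a \<Rightarrow> 'a" and h :: 'b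
  assumes "group N" and "group H" and "\<phi> \<in> hom H (AutoGroup N)"
    and "indirect_isometry H h"
  shows "indirect_isometry (semidirect_product N H \<phi>) (\<one>\<^bsub>N\<^esub>, h)"
proof -
  have h: "h \<in> carrier H" "\<not> direct_isometry H h"
    using assms(4) by (auto simp: indirect_isometry_def)
  have "(\<one>\<^bsub>N\<^esub>, h) \<in> carrier (semidirect_product N H \<phi>)"
    using hom_in_carrier[OF semidirect_product_embedding(1)[OF assms(1-3)] h(1)] .
  \<comment> \<open>Otherwise \<open>snd\<close> would turn squares with product
    \<open>(\<one>, h)\<close> into squares in \<open>H\<close> with product
    \<open>h\<close>.\<close>
  moreover have "\<not> direct_isometry (semidirect_product N H \<phi>) (\<one>\<^bsub>N\<^esub>, h)"
    using direct_isometry_hom[OF group_semidirect_product[OF assms(1-3)] assms(2)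
        semidirect_product_projection] h(2)
    by fastforce
  ultimately show ?thesis
    by (simp add: indirect_isometry_def)
qed

end
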